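(* For all $i,j\in\mathbb N$, $$C_i\star C_j=C_j\star C_i .$$
   Context: $\mathbb F$ is a field and $q\in\mathbb F$ is nonzero and not a root of unity. $\mathbb N=\{0,1,2,\ldots\}$ and $[n]_q=\frac{q^n-q^{-n}}{q-q^{-1}}$ for $n\in\mathbb N$. $\mathbb V$ is the free (associative unital) $\mathbb F$-algebra on noncommuting generators $x,y$ (its product, concatenation, is written by juxtaposition). It has a basis of words $v_1\cdots v_n$ with $v_i\in\{x,y\}$, $n\ge0$; the word of length $0$ is $1$ (trivial). Put $\langle x,x\rangle=\langle y,y\rangle=2$, $\langle x,y\rangle=\langle y,x\rangle=-2$. The $q$-shuffle product $\star$ is the bilinear associative product on the vector space $\mathbb V$ with $1\star v=v\star 1=v$ and, for nontrivial words $u=u_1\cdots u_r$, $v=v_1\cdots v_s$, $$u\star v=u_1\bigl((u_2\cdots u_r)\star v\bigr)+v_1\bigl(u\star(v_2\cdots v_s)\bigr)q^{\langle u_1,v_1\rangle+\langle u_2,v_1\rangle+\cdots+\langle u_r,v_1\rangle}.$$ Put $\overline x=1$, $\overline y=-1$. A word $a_1\cdots a_m$ is Catalan if $\overline a_1+\cdots+\overline a_m=0$ and $\overline a_1+\cdots+\overline a_i\ge0$ for $1\le i\le m$. For $n\ge 0$ the $n$th Catalan element is $$C_n=\sum a_1a_2\cdots a_{2n}\,[1]_q[1+\overline a_1]_q[1+\overline a_1+\overline a_2]_q\cdots[1+\overline a_1+\cdots+\overline a_{2n}]_q,$$ the sum being over all Catalan words $a_1\cdots a_{2n}$ of length $2n$;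 in particular $C_0=1$. *)

theory Defs
  imports Complex_Main "HOL-Library.Poly_Mapping"
begin

text \<open>
  Words form a monoid under concatenation, written additively.  With this instance the
  multiplication that \<open>HOL-Library.Poly_Mapping\<close> provides on finitely supported functions
  \<open>letter list \<Rightarrow>\<^sub>0 'a\<close> is the bilinear extension of concatenation, so this type is the free
  associative unital algebra on the two letters, with the words \<open>single w 1\<close> as a basis.
\<close>

instantiation list :: (type) monoid_add
begin

definition zero_list :: "'a list" where "zero_list = []"

definition plus_list :: "'a list \<Rightarrow> 'a list \<Rightarrow> 'a list" where "plus_list u v = u @ v"

instance
  by standard (simp_all add: zero_list_def plus_list_def)

end

datatype letter = X | Y

type_synonym word = "letter list"

type_synonym 'a free_alg = "word \<Rightarrow>\<^sub>0 'a"

abbreviation of_word :: "word \<Rightarrow> 'a::field free_alg" where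
  "of_word w \<equiv> Poly_Mapping.single w 1"

definition scale :: "'a::field \<Rightarrow> 'a free_alg \<Rightarrow> 'a free_alg" where
  "scale c f = Poly_Mapping.map ((*) c) f"

definition form :: "letter \<Rightarrow> letter \<Rightarrow> int" where
  "form a b = (if a = b then 2 else -2)"

fun qshuffle_word :: "'a::field \<Rightarrow> word \<Rightarrow> word \<Rightarrow> 'a free_alg" where
  "qshuffle_word q [] v = of_word v"
| "qshuffle_word q u [] = of_word u"
| "qshuffle_word q (a # u) (b # v) =
     of_word [a] * qshuffle_word q u (b # v) +
     scale (q powi (\<Sum>c\<leftarrow>a # u. form c b)) (of_word [b] * qshuffle_word q (a # u) v)"

definition qshuffle :: "'a::field \<Rightarrow> 'a free_alg \<Rightarrow> 'a free_alg \<Rightarrow> 'a free_alg" where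
  "qshuffle q f g =
     (\<Sum>u\<in>Poly_Mapping.keys f. \<Sum>v\<in>Poly_Mapping.keys g.
        scale (Poly_Mapping.lookup f u * Poly_Mapping.lookup g v) (qshuffle_word q u v))"

definition qint :: "'a::field \<Rightarrow> int \<Rightarrow> 'a" where
  "qint q n = (q powi n - q powi (- n)) / (q - inverse q)"

fun wt :: "letter \<Rightarrow> int" where
  "wt X = 1"
| "wt Y = -1"

definition height :: "word \<Rightarrow> nat \<Rightarrow> int" where
  "height w i = (\<Sum>a\<leftarrow>take i w. wt a)"

definition Catalan_word :: "word \<Rightarrow> bool" where
  "Catalan_word w \<longleftrightarrow> height w (length w) = 0 \<and> (\<forall>i\<in>{1..length w}. 0 \<le> height w i)"

definition Catalan_elt :: "'a::field \<Rightarrow> nat \<Rightarrow> 'a free_alg" where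
  "Catalan_elt q n =
     (\<Sum>w | Catalan_word w \<and> length w = 2 * n.
        scale (\<Prod>i=0..2 * n. qint q (1 + height w i)) (of_word w))"

text \<open>Sanity checks: the index set of the last sum is finite, \<open>C\<^sub>0 = 1\<close>, and the product is
  bilinear, has unit \<open>1\<close> and agrees with \<^const>\<open>qshuffle_word\<close> on words.\<close>

lemma finite_Catalan_words: "finite {w. Catalan_word w \<and> length w = n}"
proof -
  have U: "(UNIV :: letter set) = {X, Y}"
    using letter.exhaust by auto
  have "finite {w :: word. set w \<subseteq> UNIV \<and> length w = n}"
    by (rule finite_lists_length_eq) (simp add: U)
  then show ?thesis
    by (rule rev_finite_subset) auto
qed

lemma lookup_scale [simp]: "Poly_Mapping.lookup (scale c f) w = c * Poly_Mapping.lookup f w"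
  by (simp add: scale_def Poly_Mapping.map.rep_eq when_def)

lemma scale_0_left [simp]: "scale 0 f = 0"
  by (rule poly_mapping_eqI) simp

lemma scale_1 [simp]: "scale 1 f = f"
  by (rule poly_mapping_eqI) simp

lemma scale_scale: "scale c (scale d f) = scale (c * d) f"
  by (rule poly_mapping_eqI) (simp add: mult.assoc)

lemma scale_add_left: "scale (c + d) f = scale c f + scale d f"
  by (rule poly_mapping_eqI) (simp add: lookup_add distrib_right)

lemma scale_sum: "scale c (sum f A) = (\<Sum>x\<in>A. scale c (f x))"
  by (rule poly_mapping_eqI) (simp add: lookup_sum sum_distrib_left)

lemma qshuffle_superset:
  assumes "finite A" "Poly_Mapping.keys f \<subseteq> A" "finite B" "Poly_Mapping.keys g \<subseteq> B"
  shows "qshuffle q f g =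
     (\<Sum>u\<in>A. \<Sum>v\<in>B. scale (Poly_Mapping.lookup f u * Poly_Mapping.lookup g v) (qshuffle_word q u v))"
proof -
  have "qshuffle q f g = (\<Sum>u\<in>Poly_Mapping.keys f. \<Sum>v\<in>B.
      scale (Poly_Mapping.lookup f u * Poly_Mapping.lookup g v) (qshuffle_word q u v))"
    unfolding qshuffle_def using assms
    by (intro sum.cong refl sum.mono_neutral_left) (auto simp: in_keys_iff)
  also have "\<dots> = (\<Sum>u\<in>A. \<Sum>v\<in>B.
      scale (Poly_Mapping.lookup f u * Poly_Mapping.lookup g v) (qshuffle_word q u v))"
    using assms by (intro sum.mono_neutral_left) (auto simp: in_keys_iff)
  finally show ?thesis .
qed

lemma qshuffle_add_left: "qshuffle q (f + f') g = qshuffle q f g + qshuffle q f' g"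
proof -
  let ?A = "Poly_Mapping.keys f \<union> Poly_Mapping.keys f'" and ?B = "Poly_Mapping.keys g"
  have "Poly_Mapping.keys (f + f') \<subseteq> ?A"
    by (rule Poly_Mapping.keys_add)
  then show ?thesis
    by (simp add: qshuffle_superset[of ?A _ ?B] lookup_add distrib_right scale_add_left sum.distrib)
qed

lemma qshuffle_add_right: "qshuffle q f (g + g') = qshuffle q f g + qshuffle q f g'"
proof -
  let ?A = "Poly_Mapping.keys f" and ?B = "Poly_Mapping.keys g \<union> Poly_Mapping.keys g'"
  have "Poly_Mapping.keys (g + g') \<subseteq> ?B"
    by (rule Poly_Mapping.keys_add)
  then show ?thesis
    by (simp add: qshuffle_superset[of ?A _ ?B] lookup_add distrib_left scale_add_left sum.distrib)
qed

lemma keys_scale_subset: "Poly_Mapping.keys (scale c f) \<subseteq> Poly_Mapping.keys f"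
  by (auto simp: in_keys_iff)

lemma qshuffle_scale_left: "qshuffle q (scale c f) g = scale c (qshuffle q f g)"
  by (simp add: qshuffle_superset[of "Poly_Mapping.keys f" _ "Poly_Mapping.keys g"]
      keys_scale_subset scale_sum scale_scale mult.assoc)

lemma qshuffle_scale_right: "qshuffle q f (scale c g) = scale c (qshuffle q f g)"
  by (simp add: qshuffle_superset[of "Poly_Mapping.keys f" _ "Poly_Mapping.keys g"]
      keys_scale_subset scale_sum scale_scale mult.left_commute)

lemma qshuffle_of_word: "qshuffle q (of_word u) (of_word v) = qshuffle_word q u v"
  by (simp add: qshuffle_def)

lemma qshuffle_word_Nil_right: "qshuffle_word q u [] = of_word u"
  by (cases u) simp_all

lemma sum_of_word: "(\<Sum>v\<in>Poly_Mapping.keys f. scale (Poly_Mapping.lookup f v) (of_word v)) = f"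
  by (rule poly_mapping_eqI)
    (auto simp: lookup_sum lookup_single when_def in_keys_iff if_distrib sum.If_cases
      cong: if_cong)

lemma one_eq_of_word: "1 = of_word []"
  by (simp flip: single_one add: zero_list_def)

lemma qshuffle_one_left: "qshuffle q 1 f = f"
  unfolding one_eq_of_word by (simp add: qshuffle_def sum_of_word)

lemma qshuffle_one_right: "qshuffle q f 1 = f"
  unfolding one_eq_of_word by (simp add: qshuffle_def sum_of_word qshuffle_word_Nil_right)

lemma Catalan_elt_0:
  assumes "q - inverse q \<noteq> 0"
  shows "Catalan_elt q 0 = 1"
proof -
  have *: "{w. Catalan_word w \<and> w = []} = {[]}"
    by (auto simp: Catalan_word_def height_def)
  show ?thesis
    using assms by (simp add: Catalan_elt_def * height_def qint_def one_eq_of_word power_int_minus)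
qed

end

theory Submission
  imports Defs "HOL-Computational_Algebra.Polynomial"
begin

text \<open>
  Every coefficient of a \<open>q\<close>-shuffle product can be computed by stripping the letters of
  the word from the left: stripping a letter is a twisted derivation of \<open>\<star>\<close>
  (\<open>lookup_qshuffle\<close>).  The Catalan elements belong to a family, indexed by a starting height
  \<open>k\<close>, of weighted sums over all paths from height \<open>k\<close> down to height \<open>0\<close>; stripping \<open>x\<close> moves
  \<open>k\<close> up and stripping \<open>y\<close> moves \<open>k\<close> down.  If the paths with \<open>n\<close> down-steps are also weighted
  by \<open>s ^ n\<close>, the index \<open>k\<close> labels a basis of an infinite-dimensional evaluation module \<open>V(s)\<close>,
  a Verma module for \<open>U\<^sub>q(sl\<^sub>2)\<close> on which \<open>x\<close> is a raising and \<open>y\<close> a lowering operator.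
  The coefficients of \<open>(\<Sum> s ^ i C\<^sub>i) \<star> (\<Sum> t ^ j C\<^sub>j)\<close> are then matrix entries, between lowest
  weight vectors, of words in the two operators acting on \<open>V(s) \<otimes> V(t)\<close> (\<open>path_shuffle_coef\<close>).

  The theorem therefore says that these matrix entries are symmetric in \<open>s\<close> and \<open>t\<close>, and the
  reason is the \<open>R\<close>-matrix \<open>V(s) \<otimes> V(t) \<rightarrow> V(t) \<otimes> V(s)\<close>.  It commutes with one copy of
  \<open>U\<^sub>q(sl\<^sub>2)\<close>, so it only rescales the singular vectors \<open>\<Omega>\<^sub>n\<close> (one in each degree \<open>n\<close>, and they
  do not depend on \<open>s\<close>, \<open>t\<close>), the scalar being \<open>D\<^sub>n(t,s) / D\<^sub>n(s,t)\<close> with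
  \<open>D\<^sub>n(s,t) = (s - q\<^sup>-\<^sup>4 t) (s - q\<^sup>-\<^sup>6 t) \<dots> (s - q\<^sup>-\<^sup>2\<^sup>n\<^sup>-\<^sup>2 t)\<close>.  No intertwiner is
  constructed.  Instead, take the families of vectors, depending on \<open>s\<close> and \<open>t\<close>, that are generated
  from the vectors \<open>D\<^sub>n(s,t) \<Omega>\<^sub>n\<close> by the raising operator and by combinations whose coefficients
  are symmetric in \<open>s\<close> and \<open>t\<close> (\<open>symmetric_family\<close>).  This class is closed under the
  lowering operator (\<open>symmetric_family_lower\<close>): by the cubic \<open>q\<close>-Serre relation this needs to
  be checked only on \<open>\<Omega>\<^sub>n\<close> and its first two raised images, where it comes down to the factorisation
  of finitely many scalars.  Since all members have a component at the lowest weight vector that is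
  symmetric in \<open>s\<close> and \<open>t\<close>, so have their images under all words.

  Finally \<open>q\<close> is not a root of unity, so the field is infinite and the symmetry for all values of
  \<open>s\<close>, with \<open>t = 1\<close>, separates the degrees \<open>i\<close> and \<open>j\<close>.
\<close>

section \<open>Coefficients of shuffle products\<close>

definition twist :: "'a::field \<Rightarrow> letter \<Rightarrow> (word \<Rightarrow> 'a) \<Rightarrow> word \<Rightarrow> 'a" where
  "twist q a f u = q powi (\<Sum>c\<leftarrow>u. form c a) * f u"

text \<open>
  The shuffle product of two arbitrary functions on words, that is, of formal series.  Recursion on
  the word at which the product is evaluated makes the twisted Leibniz rule the definition.
\<close>

primrec shuf :: "'a::field \<Rightarrow> word \<Rightarrow> (word \<Rightarrow> 'a) \<Rightarrow> (word \<Rightarrow> 'a) \<Rightarrow> 'a" where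
  "shuf q [] f g = f [] * g []"
| "shuf q (a # w) f g =
     shuf q w (\<lambda>u. f (a # u)) g + shuf q w (twist q a f) (\<lambda>u. g (a # u))"

lemma twist_add: "twist q a (\<lambda>u. f u + g u) = (\<lambda>u. twist q a f u + twist q a g u)"
  by (auto simp: twist_def distrib_left)

lemma twist_scale: "twist q a (\<lambda>u. c * f u) = (\<lambda>u. c * twist q a f u)"
  by (auto simp: twist_def)

lemma twist_zero: "twist q a (\<lambda>u. 0) = (\<lambda>u. 0)"
  by (auto simp: twist_def)

lemma shuf_zero_left [simp]: "shuf q w (\<lambda>u. 0) g = 0"
  by (induction w arbitrary: g) (simp_all add: twist_zero)

lemma shuf_zero_right [simp]: "shuf q w f (\<lambda>u. 0) = 0"
  by (induction w arbitrary: f) simp_all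

lemma shuf_add_left: "shuf q w (\<lambda>u. f u + f' u) g = shuf q w f g + shuf q w f' g"
  by (induction w arbitrary: f f' g) (simp_all add: twist_add distrib_right)

lemma shuf_add_right: "shuf q w f (\<lambda>u. g u + g' u) = shuf q w f g + shuf q w f g'"
  by (induction w arbitrary: f g g') (simp_all add: distrib_left)

lemma shuf_scale_left: "shuf q w (\<lambda>u. c * f u) g = c * shuf q w f g"
  by (induction w arbitrary: f g) (simp_all add: twist_scale distrib_left)

lemma shuf_scale_right: "shuf q w f (\<lambda>u. c * g u) = c * shuf q w f g"
  by (induction w arbitrary: f g) (simp_all add: distrib_left)

lemma shuf_sum_left: "shuf q w (\<lambda>u. \<Sum>i\<in>A. f i u) g = (\<Sum>i\<in>A. shuf q w (f i) g)"
  by (induction A rule: infinite_finite_induct) (simp_all add: shuf_add_left)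

lemma shuf_sum_right: "shuf q w f (\<lambda>u. \<Sum>i\<in>A. g i u) = (\<Sum>i\<in>A. shuf q w f (g i))"
  by (induction A rule: infinite_finite_induct) (simp_all add: shuf_add_right)

lemma of_word_letter_times:
  "of_word [a] * f = (\<Sum>v\<in>Poly_Mapping.keys f. scale (Poly_Mapping.lookup f v) (of_word (a # v)))"
proof -
  have "of_word [a] * scale c (of_word v) = scale c (of_word (a # v))" for c :: 'a and v
    by (rule poly_mapping_eqI)
      (simp add: scale_def map_single mult_single plus_list_def)
  then show ?thesis
    by (subst (1) sum_of_word[symmetric]) (simp add: sum_distrib_left)
qed

lemma lookup_letter_times:
  "Poly_Mapping.lookup (of_word [a] * f) [] = 0"
  "Poly_Mapping.lookup (of_word [a] * f) (b # w) = (if a = b then Poly_Mapping.lookup f w else 0)"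
proof -
  show "Poly_Mapping.lookup (of_word [a] * f) [] = 0"
    by (simp add: of_word_letter_times lookup_sum lookup_single when_def)
  have "Poly_Mapping.lookup (of_word [a] * f) (b # w) =
      (\<Sum>v\<in>Poly_Mapping.keys f. if v = w then (if a = b then Poly_Mapping.lookup f v else 0) else 0)"
    unfolding of_word_letter_times lookup_sum
    by (intro sum.cong refl) (auto simp: lookup_single when_def)
  then show "Poly_Mapping.lookup (of_word [a] * f) (b # w) =
      (if a = b then Poly_Mapping.lookup f w else 0)"
    by (auto simp: in_keys_iff)
qed

definition word_delta :: "word \<Rightarrow> word \<Rightarrow> 'a::field" where
  "word_delta v u = (if u = v then 1 else 0)"

lemma word_delta_Cons:
  "(\<lambda>u. word_delta (a # v) (c # u)) = (\<lambda>u. (if a = c then 1 else 0) * word_delta v u)"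
  "(\<lambda>u. word_delta [] (c # u)) = (\<lambda>u. 0)"
  by (auto simp: word_delta_def)

lemma twist_word_delta:
  "twist q a (word_delta v) = (\<lambda>u. q powi (\<Sum>c\<leftarrow>v. form c a) * word_delta v u)"
  by (auto simp: twist_def word_delta_def)

lemma shuf_word_delta_Nil:
  "shuf q w (word_delta []) (word_delta v) = word_delta v w"
proof (induction w arbitrary: v)
  case Nil
  then show ?case by (auto simp: word_delta_def)
next
  case (Cons c w)
  then show ?case
    by (cases v) (simp_all add: word_delta_Cons twist_word_delta shuf_scale_right
        word_delta_def[of _ "c # w"] word_delta_def[of _ w])
qed

lemma shuf_word_delta_Nil_right:
  "shuf q w (word_delta v) (word_delta []) = word_delta v w"
proof (induction w arbitrary: v)
  case Nil
  then show ?case by (auto simp: word_delta_def)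
next
  case (Cons c w)
  then show ?case
    by (cases v) (simp_all add: word_delta_Cons shuf_scale_left
        word_delta_def[of _ "c # w"] word_delta_def[of _ w])
qed

lemma lookup_qshuffle_word:
  "Poly_Mapping.lookup (qshuffle_word q u v) w = shuf q w (word_delta u) (word_delta v)"
proof (induction q u v arbitrary: w rule: qshuffle_word.induct)
  case (1 q v)
  then show ?case
    by (simp add: shuf_word_delta_Nil lookup_single when_def) (auto simp: word_delta_def)
next
  case (2 q a u)
  then show ?case
    by (simp add: shuf_word_delta_Nil_right lookup_single when_def) (auto simp: word_delta_def)
next
  case (3 q a u b v)
  show ?case
  proof (cases w)
    case Nil
    then show ?thesis
      by (simp add: lookup_add lookup_letter_times word_delta_def)
  next
    case (Cons c w')
    then show ?thesis
      unfolding Cons qshuffle_word.simps lookup_add lookup_scale lookup_letter_times shuf.simps 3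
        word_delta_Cons twist_word_delta shuf_scale_left shuf_scale_right
      by simp
  qed
qed

lemma lookup_qshuffle:
  "Poly_Mapping.lookup (qshuffle q f g) w =
   shuf q w (Poly_Mapping.lookup f) (Poly_Mapping.lookup g)"
proof -
  have expand: "Poly_Mapping.lookup h =
      (\<lambda>u. \<Sum>v\<in>Poly_Mapping.keys h. Poly_Mapping.lookup h v * word_delta v u)"
    for h :: "'a free_alg"
    by (rule ext) (auto simp: word_delta_def in_keys_iff if_distrib sum.If_cases cong: if_cong)
  have "shuf q w (Poly_Mapping.lookup f) (Poly_Mapping.lookup g) = shuf q w
      (\<lambda>u. \<Sum>v\<in>Poly_Mapping.keys f. Poly_Mapping.lookup f v * word_delta v u)
      (\<lambda>u. \<Sum>v\<in>Poly_Mapping.keys g. Poly_Mapping.lookup g v * word_delta v u)"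
    by (rule arg_cong2[where f = "shuf q w", OF expand expand])
  then show ?thesis
    unfolding shuf_sum_left shuf_sum_right shuf_scale_left shuf_scale_right
    by (simp add: qshuffle_def lookup_sum lookup_qshuffle_word sum_distrib_left mult_ac)
qed

section \<open>Grading by the number of down-steps\<close>

abbreviation downs :: "word \<Rightarrow> nat" where
  "downs w \<equiv> count_list w Y"

definition graded_part :: "nat \<Rightarrow> (word \<Rightarrow> 'a::field) \<Rightarrow> word \<Rightarrow> 'a" where
  "graded_part n f u = (if downs u = n then f u else 0)"

lemma graded_part_X: "(\<lambda>u. graded_part n f (X # u)) = graded_part n (\<lambda>u. f (X # u))"
  by (auto simp: graded_part_def)

lemma graded_part_Y:
  "(\<lambda>u. graded_part 0 f (Y # u)) = (\<lambda>u. 0)"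
  "(\<lambda>u. graded_part (Suc n) f (Y # u)) = graded_part n (\<lambda>u. f (Y # u))"
  by (auto simp: graded_part_def)

lemma twist_graded_part: "twist q a (graded_part n f) = graded_part n (twist q a f)"
  by (auto simp: graded_part_def twist_def)

lemma shuf_graded_part_eq_0:
  "i + j \<noteq> downs w \<Longrightarrow> shuf q w (graded_part i f) (graded_part j g) = 0"
proof (induction w arbitrary: i j f g)
  case Nil
  then show ?case by (auto simp: graded_part_def)
next
  case (Cons a w)
  show ?case
  proof (cases a)
    case X
    then show ?thesis
      using Cons by (simp add: graded_part_X twist_graded_part)
  next
    case Y
    then show ?thesis
      using Cons by (cases i; cases j) (simp_all add: graded_part_Y twist_graded_part)
  qed
qed

lemma shuf_weighted:
  "shuf q w (\<lambda>u. s ^ downs u * f u) (\<lambda>u. t ^ downs u * g u) =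
   (\<Sum>i\<le>downs w. s ^ i * t ^ (downs w - i) *
      shuf q w (graded_part i f) (graded_part (downs w - i) g))"
proof (induction w arbitrary: f g)
  case Nil
  then show ?case by (simp add: graded_part_def)
next
  case (Cons a w)
  have tw: "twist q b (\<lambda>u. s ^ downs u * f u) = (\<lambda>u. s ^ downs u * twist q b f u)" for b
    by (auto simp: twist_def)
  show ?case
  proof (cases a)
    case X
    then show ?thesis
      by (simp add: tw Cons graded_part_X twist_graded_part distrib_left sum.distrib)
  next
    case Y
    have shift: "(\<lambda>u. r ^ downs (Y # u) * h (Y # u)) = (\<lambda>u. r * (r ^ downs u * h (Y # u)))"
      for r :: 'a and h by (auto simp: mult.assoc)
    let ?m = "downs w"
    let ?F = "\<lambda>i. s ^ i * t ^ (Suc ?m - i) *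
      shuf q w (\<lambda>u. graded_part i f (Y # u)) (graded_part (Suc ?m - i) g)"
    let ?G = "\<lambda>i. s ^ i * t ^ (Suc ?m - i) *
      shuf q w (twist q Y (graded_part i f)) (\<lambda>u. graded_part (Suc ?m - i) g (Y # u))"
    have "(\<Sum>i\<le>Suc ?m. ?F i) =
        s * shuf q w (\<lambda>u. s ^ downs u * f (Y # u)) (\<lambda>u. t ^ downs u * g u)"
      unfolding sum.atMost_Suc_shift Cons by (simp add: graded_part_Y sum_distrib_left mult_ac)
    moreover have "(\<Sum>i\<le>Suc ?m. ?G i) =
        t * shuf q w (\<lambda>u. s ^ downs u * twist q Y f u) (\<lambda>u. t ^ downs u * g (Y # u))"
      unfolding Cons
      by (simp add: graded_part_Y twist_graded_part sum_distrib_left mult_ac Suc_diff_le)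
    ultimately show ?thesis
      using Y by (simp only: shuf.simps shift tw shuf_scale_left shuf_scale_right)
        (simp add: distrib_left sum.distrib)
  qed
qed

section \<open>Weighted paths and Catalan elements\<close>

definition qq :: "'a::field \<Rightarrow> int \<Rightarrow> 'a" where
  "qq q j = q powi (2 * j)"

lemma qq_add: "q \<noteq> 0 \<Longrightarrow> qq q (i + j) = qq q i * qq q j"
  by (simp add: qq_def power_int_add distrib_left)

lemma qq_minus: "qq q (- j) = inverse (qq q j)"
  by (simp add: qq_def power_int_minus)

lemma qq_diff: "q \<noteq> 0 \<Longrightarrow> qq q (i - j) = qq q i / qq q j"
  by (simp add: qq_def power_int_diff right_diff_distrib)

lemma qq_nonzero: "q \<noteq> 0 \<Longrightarrow> qq q j \<noteq> 0"
  by (simp add: qq_def)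

lemma qq_of_nat: "qq q (int n) = (q^2) ^ n"
  by (simp add: qq_def power_int_def nat_mult_distrib power_mult)

lemma qq_numeral: "qq q 0 = 1" "qq q 1 = q^2" "qq q (numeral m) = (q^2) ^ numeral m"
  using qq_of_nat[of q 0] qq_of_nat[of q 1] qq_of_nat[of q "numeral m"] by simp_all

definition step_weight :: "'a::field \<Rightarrow> int \<Rightarrow> 'a" where
  "step_weight q j = qint q j * qint q (j + 1)"

text \<open>
  In a closed path every up-step is matched by a down-step between the same two heights, so the
  factors \<open>[1 + height]\<close> at the ends of both can be charged to the up-step.  A path that dips below height
  \<open>0\<close> must return through an up-step from \<open>-1\<close> to \<open>0\<close>, whose weight \<open>[0] [1]\<close> vanishes.
\<close>

primrec path_weight :: "'a::field \<Rightarrow> int \<Rightarrow> word \<Rightarrow> 'a" where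
  "path_weight q k [] = (if k = 0 then 1 else 0)"
| "path_weight q k (a # w) =
     (case a of X \<Rightarrow> step_weight q (k + 1) * path_weight q (k + 1) w
      | Y \<Rightarrow> path_weight q (k - 1) w)"

lemma qint_0 [simp]: "qint q 0 = 0"
  by (simp add: qint_def)

lemma path_weight_neg: "k < 0 \<Longrightarrow> path_weight q k w = 0"
proof (induction w arbitrary: k)
  case (Cons a w)
  then show ?case
    by (cases "k = -1") (auto simp: step_weight_def split: letter.split)
qed simp

lemma height_simps [simp]:
  "height w 0 = 0" "height (a # w) (Suc i) = wt a + height w i"
  by (simp_all add: height_def)

lemma path_weight_nonzeroD:
  assumes "path_weight q k w \<noteq> 0"
  shows "k + height w (length w) = 0" "0 \<le> k + height w i"
proof -
  have "k + height w (length w) = 0 \<and> (\<forall>i. 0 \<le> k + height w i)"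
    using assms
  proof (induction w arbitrary: k)
    case Nil
    then show ?case by (auto simp: height_def split: if_splits)
  next
    case (Cons a w)
    have k: "0 \<le> k"
      using Cons.prems path_weight_neg[of k q "a # w"] by linarith
    have "path_weight q (k + wt a) w \<noteq> 0"
      using Cons.prems by (cases a) auto
    note IH = Cons.IH[OF this]
    have "0 \<le> k + height (a # w) i" for i
      using k IH by (cases i) (auto simp: algebra_simps)
    then show ?case
      using IH by (auto simp: algebra_simps)
  qed
  then show "k + height w (length w) = 0" "0 \<le> k + height w i"
    by auto
qed

lemma sum_wt_eq_height: "(\<Sum>c\<leftarrow>w. wt c) = height w (length w)"
  by (simp add: height_def)

text \<open>
  A path from height \<open>k\<close> down to \<open>0\<close> also has \<open>k\<close> unmatched down-steps; together with the
  starting point they account for the factors \<open>[1], \<dots>, [k + 1]\<close>.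
\<close>

lemma prod_qint_path_weight:
  assumes "int k + height w (length w) = 0"
  shows "(\<Prod>i=0..length w. qint q (1 + int k + height w i)) =
    (\<Prod>j=1..k + 1. qint q (int j)) * path_weight q (int k) w"
  using assms
proof (induction w arbitrary: k)
  case Nil
  then show ?case by (auto simp: height_def)
next
  case (Cons a w)
  have split: "(\<Prod>i=0..length (a # w). qint q (1 + int k + height (a # w) i)) =
      qint q (1 + int k) * (\<Prod>i=0..length w. qint q (1 + (int k + wt a) + height w i))"
    unfolding length_Cons prod.atLeast0_atMost_Suc_shift by (simp add: add.assoc)
  show ?case
  proof (cases a)
    case X
    have "(\<Prod>i=0..length w. qint q (1 + (int k + wt a) + height w i)) =
        (\<Prod>j=1..Suc k + 1. qint q (int j)) * path_weight q (int (Suc k)) w"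
      using Cons.IH[of "Suc k"] Cons.prems X by (simp add: algebra_simps)
    then show ?thesis
      unfolding split using X by (simp add: step_weight_def algebra_simps)
  next
    case Y
    show ?thesis
    proof (cases k)
      case 0
      have "(\<Prod>i=0..length w. qint q (1 + (int k + wt a) + height w i)) = 0"
        using Y 0 by (intro prod_zero bexI[of _ 0]) auto
      then show ?thesis
        unfolding split using Y 0 by (simp add: path_weight_neg)
    next
      case (Suc k')
      then have "(\<Prod>i=0..length w. qint q (1 + (int k + wt a) + height w i)) =
          (\<Prod>j=1..k' + 1. qint q (int j)) * path_weight q (int k') w"
        using Cons.IH[of k'] Cons.prems Y by (simp add: algebra_simps)
      then show ?thesis
        unfolding split using Y Suc by (simp add: algebra_simps)
    qed
  qed
qed

lemma length_eq_downs: "height w (length w) = int (length w) - 2 * int (downs w)"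
proof (induction w)
  case (Cons a w)
  then show ?case by (cases a) auto
qed simp

lemma lookup_Catalan_elt:
  assumes "qint q 1 = 1"
  shows "Poly_Mapping.lookup (Catalan_elt q n) = graded_part n (path_weight q 0)"
proof
  fix w
  have fin: "finite {w. Catalan_word w \<and> length w = 2 * n}"
    by (rule finite_Catalan_words)
  have *: "Poly_Mapping.lookup (Catalan_elt q n) w =
      (if Catalan_word w \<and> length w = 2 * n then \<Prod>i=0..2 * n. qint q (1 + height w i) else 0)"
    using fin by (simp add: Catalan_elt_def lookup_sum lookup_single when_def if_distrib
        sum.If_cases cong: if_cong)
  show "Poly_Mapping.lookup (Catalan_elt q n) w = graded_part n (path_weight q 0) w"
  proof (cases "Catalan_word w \<and> length w = 2 * n")
    case True
    then have "height w (length w) = 0"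
      unfolding Catalan_word_def by blast
    moreover from this have "downs w = n"
      using True length_eq_downs[of w] by simp
    ultimately show ?thesis
      unfolding * using True prod_qint_path_weight[of 0 w q] assms
      by (simp add: graded_part_def)
  next
    case False
    have "graded_part n (path_weight q 0) w = 0"
    proof (rule ccontr)
      assume "graded_part n (path_weight q 0) w \<noteq> 0"
      then have "downs w = n" and nz: "path_weight q 0 w \<noteq> 0"
        by (auto simp: graded_part_def split: if_splits)
      with False path_weight_nonzeroD[OF nz] length_eq_downs[of w] show False
        by (auto simp: Catalan_word_def)
    qed
    with False show ?thesis
      unfolding * by (simp only: if_False)
  qed
qed

section \<open>Raising and lowering operators on the tensor product\<close>

text \<open>
  A vector of \<open>V(s) \<otimes> V(t)\<close> is given by its coordinates at the basis vectors \<open>(k, l)\<close> with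
  \<open>k, l \<ge> 0\<close>.  The coordinates are scaled by \<open>gauge\<close> below so that the singular vectors become
  constant along the lines \<open>k + l = n\<close>.  Arbitrary integer indices avoid boundary cases: the
  step weight vanishes at \<open>0\<close>, so no coordinate outside the quadrant ever influences one
  inside.
\<close>

type_synonym 'a vec = "int \<Rightarrow> int \<Rightarrow> 'a"

definition raise :: "'a::field \<Rightarrow> 'a vec \<Rightarrow> 'a vec" where
  "raise q p k l = step_weight q l * p k (l - 1)
     - qq q (k + l + 1) * step_weight q k * p (k - 1) l"

definition lower :: "'a::field \<Rightarrow> 'a \<Rightarrow> 'a \<Rightarrow> 'a vec \<Rightarrow> 'a vec" where
  "lower q s t p k l = t * p k (l + 1) - s * qq q (- (k + l + 2)) * p (k + 1) l"

lemma raise_add: "raise q (\<lambda>k l. p k l + p' k l) = (\<lambda>k l. raise q p k l + raise q p' k l)"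
  by (intro ext) (simp add: raise_def algebra_simps)

lemma raise_scale: "raise q (\<lambda>k l. c * p k l) = (\<lambda>k l. c * raise q p k l)"
  by (intro ext) (simp add: raise_def algebra_simps)

lemma lower_add:
  "lower q s t (\<lambda>k l. p k l + p' k l) = (\<lambda>k l. lower q s t p k l + lower q s t p' k l)"
  by (intro ext) (simp add: lower_def algebra_simps)

lemma lower_scale: "lower q s t (\<lambda>k l. c * p k l) = (\<lambda>k l. c * lower q s t p k l)"
  by (intro ext) (simp add: lower_def algebra_simps)

text \<open>The letters act in the order in which they are stripped from the word, the leftmost first.\<close>

primrec coef :: "'a::field \<Rightarrow> 'a \<Rightarrow> 'a \<Rightarrow> word \<Rightarrow> 'a vec \<Rightarrow> 'a" where
  "coef q s t [] p = p 0 0"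
| "coef q s t (a # w) p =
     (case a of X \<Rightarrow> coef q s t w (raise q p) | Y \<Rightarrow> coef q s t w (lower q s t p))"

lemma coef_add: "coef q s t w (\<lambda>k l. p k l + p' k l) = coef q s t w p + coef q s t w p'"
  by (induction w arbitrary: p p') (simp_all add: raise_add lower_add split: letter.split)

lemma coef_scale: "coef q s t w (\<lambda>k l. c * p k l) = c * coef q s t w p"
  by (induction w arbitrary: p) (simp_all add: raise_scale lower_scale split: letter.split)

definition unit_vec :: "int \<Rightarrow> int \<Rightarrow> 'a::field vec" where
  "unit_vec i j k l = (if k = i \<and> l = j then 1 else 0)"

lemma raise_unit_vec:
  "raise q (unit_vec i j) = (\<lambda>k l. step_weight q (j + 1) * unit_vec i (j + 1) k l
     + (- qq q (i + j + 2) * step_weight q (i + 1)) * unit_vec (i + 1) j k l)"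
  by (intro ext) (auto simp: raise_def unit_vec_def algebra_simps)

lemma lower_unit_vec:
  "lower q s t (unit_vec i j) = (\<lambda>k l. t * unit_vec i (j - 1) k l
     + (- s * qq q (- (i + j + 1))) * unit_vec (i - 1) j k l)"
  by (intro ext) (auto simp: lower_def unit_vec_def algebra_simps)

text \<open>
  The coordinates, with respect to pairs of path series, of the singular vector of degree
  \<open>i + j\<close>.
\<close>

definition gauge :: "'a::field \<Rightarrow> int \<Rightarrow> int \<Rightarrow> 'a" where
  "gauge q i j = (-1) powi i * q powi (- (i * (i + 3 + 2 * j)))"

lemma gauge_shift:
  assumes "q \<noteq> 0"
  shows "gauge q i j = - qq q (i + j + 2) * gauge q (i + 1) j"
    and "gauge q i j * qq q (- i) = gauge q i (j + 1)"
proof -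
  have e: "- (i * (i + 3 + 2 * j)) = 2 * (i + j + 2) + - ((i + 1) * (i + 1 + 3 + 2 * j))"
    by (simp add: algebra_simps)
  have "q powi (- (i * (i + 3 + 2 * j))) =
      qq q (i + j + 2) * q powi (- ((i + 1) * (i + 1 + 3 + 2 * j)))"
    unfolding qq_def e using assms by (subst power_int_add) auto
  moreover have "(-1 :: 'a) powi (i + 1) = - ((-1) powi i)"
    by (simp add: power_int_add)
  ultimately show "gauge q i j = - qq q (i + j + 2) * gauge q (i + 1) j"
    by (simp add: gauge_def mult_ac)
  have e: "- (i * (i + 3 + 2 * (j + 1))) = - (i * (i + 3 + 2 * j)) + 2 * - i"
    by (simp add: algebra_simps)
  show "gauge q i j * qq q (- i) = gauge q i (j + 1)"
    unfolding gauge_def qq_def e using assms by (subst power_int_add) (auto simp: mult_ac)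
qed

definition path_series :: "'a::field \<Rightarrow> 'a \<Rightarrow> int \<Rightarrow> word \<Rightarrow> 'a" where
  "path_series q s k u = s ^ downs u * path_weight q k u"

lemma path_series_Cons:
  "(\<lambda>u. path_series q s k (X # u)) = (\<lambda>u. step_weight q (k + 1) * path_series q s (k + 1) u)"
  "(\<lambda>u. path_series q s k (Y # u)) = (\<lambda>u. s * path_series q s (k - 1) u)"
  by (auto simp: path_series_def mult_ac)

lemma twist_path_series:
  "twist q X (path_series q s k) = (\<lambda>u. qq q (- k) * path_series q s k u)"
  "twist q Y (path_series q s k) = (\<lambda>u. qq q k * path_series q s k u)"
proof -
  have "(\<Sum>c\<leftarrow>u. form c X) = 2 * (\<Sum>c\<leftarrow>u. wt c)
      \<and> (\<Sum>c\<leftarrow>u. form c Y) = 2 * - (\<Sum>c\<leftarrow>u. wt c)" for u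
  proof (induction u)
    case (Cons a u)
    then show ?case by (cases a) (auto simp: form_def)
  qed simp
  then have form: "(\<Sum>c\<leftarrow>u. form c X) = 2 * height u (length u)"
    "(\<Sum>c\<leftarrow>u. form c Y) = 2 * - height u (length u)" for u
    by (simp_all only: sum_wt_eq_height)
  have "twist q X (path_series q s k) u = qq q (- k) * path_series q s k u
    \<and> twist q Y (path_series q s k) u = qq q k * path_series q s k u" for u
  proof (cases "path_weight q k u = 0")
    case False
    from path_weight_nonzeroD(1)[OF this] have "height u (length u) = - k"
      by simp
    then show ?thesis
      unfolding twist_def form qq_def by simp
  qed (simp add: twist_def path_series_def)
  then show "twist q X (path_series q s k) = (\<lambda>u. qq q (- k) * path_series q s k u)"
    "twist q Y (path_series q s k) = (\<lambda>u. qq q k * path_series q s k u)"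
    by auto
qed

lemma path_shuffle_coef:
  assumes q: "q \<noteq> 0"
  shows "gauge q i j * shuf q w (path_series q s i) (path_series q t j) =
    coef q s t w (unit_vec i j)"
proof (induction w arbitrary: i j)
  case Nil
  then show ?case
    by (simp add: path_series_def unit_vec_def gauge_def)
next
  case (Cons a w)
  let ?S = "\<lambda>i j. shuf q w (path_series q s i) (path_series q t j)"
  show ?case
  proof (cases a)
    case X
    have "gauge q i j * shuf q (a # w) (path_series q s i) (path_series q t j) =
        step_weight q (i + 1) * (gauge q i j * ?S (i + 1) j)
        + step_weight q (j + 1) * ((gauge q i j * qq q (- i)) * ?S i (j + 1))"
      by (simp add: X path_series_Cons twist_path_series shuf_scale_left shuf_scale_right
          algebra_simps)
    also have "gauge q i j * ?S (i + 1) j =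
        - qq q (i + j + 2) * (gauge q (i + 1) j * ?S (i + 1) j)"
      by (subst gauge_shift(1)[OF q]) simp
    finally have "gauge q i j * shuf q (a # w) (path_series q s i) (path_series q t j) =
        step_weight q (i + 1) * (- qq q (i + j + 2) * coef q s t w (unit_vec (i + 1) j))
        + step_weight q (j + 1) * coef q s t w (unit_vec i (j + 1))"
      by (simp only: Cons gauge_shift(2)[OF q])
    moreover have "coef q s t (a # w) (unit_vec i j) =
        step_weight q (j + 1) * coef q s t w (unit_vec i (j + 1))
        + (- qq q (i + j + 2) * step_weight q (i + 1)) * coef q s t w (unit_vec (i + 1) j)"
      by (simp only: X coef.simps letter.case raise_unit_vec coef_add coef_scale)
    ultimately show ?thesis
      by (simp only: mult_ac add_ac)
  next
    case Y
    have up: "gauge q i j * qq q i = gauge q i (j - 1)"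
      using gauge_shift(2)[OF q, of i "j - 1"] qq_nonzero[OF q, of i]
      by (simp add: qq_minus field_simps)
    have left: "gauge q i j = - qq q (- (i + j + 1)) * gauge q (i - 1) j"
    proof -
      have "i - 1 + j + 2 = i + j + 1" "i - 1 + 1 = i"
        by simp_all
      then have "gauge q (i - 1) j = - qq q (i + j + 1) * gauge q i j"
        using gauge_shift(1)[OF q, of "i - 1" j] by (simp only:)
      moreover have "x = - inverse z * y" if "y = - z * x" "z \<noteq> 0" for x y z :: 'a
        using that by simp
      ultimately show ?thesis
        unfolding qq_minus[of q "i + j + 1"] using qq_nonzero[OF q] by blast
    qed
    have "gauge q i j * shuf q (a # w) (path_series q s i) (path_series q t j) =
        s * (gauge q i j * ?S (i - 1) j) + t * ((gauge q i j * qq q i) * ?S i (j - 1))"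
      by (simp add: Y path_series_Cons twist_path_series shuf_scale_left shuf_scale_right
          algebra_simps)
    also have "gauge q i j * ?S (i - 1) j =
        - qq q (- (i + j + 1)) * (gauge q (i - 1) j * ?S (i - 1) j)"
      by (subst left) simp
    finally have "gauge q i j * shuf q (a # w) (path_series q s i) (path_series q t j) =
        s * (- qq q (- (i + j + 1)) * coef q s t w (unit_vec (i - 1) j))
        + t * coef q s t w (unit_vec i (j - 1))"
      by (simp only: Cons up)
    moreover have "coef q s t (a # w) (unit_vec i j) =
        t * coef q s t w (unit_vec i (j - 1))
        + (- s * qq q (- (i + j + 1))) * coef q s t w (unit_vec (i - 1) j)"
      by (simp only: Y coef.simps letter.case lower_unit_vec coef_add coef_scale)
    ultimately show ?thesis
      by simp
  qed
qed

section \<open>The q-Serre relation\<close>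

definition step_const :: "'a::field \<Rightarrow> 'a" where
  "step_const q = inverse (q * (q - inverse q)^2)"

lemma step_weight_eq:
  fixes q :: "'a::field"
  assumes "q \<noteq> 0" "q^2 \<noteq> 1"
  shows "step_weight q j = step_const q * ((qq q j - 1) * (q^2 * qq q j - 1) / qq q j)"
proof -
  define u where "u = q powi j"
  have u: "u \<noteq> 0" using assms by (simp add: u_def)
  have e: "qq q j = u^2" by (simp add: qq_def u_def power_int_mult mult.commute)
  have d: "q - inverse q \<noteq> 0" using assms by (simp add: field_simps power2_eq_square)
  have 1: "q powi (j + 1) = q * u" "q powi (- (j + 1)) = inverse (q * u)" "q powi (- j) = inverse u"
    using assms by (simp_all add: u_def power_int_add power_int_minus power_int_diff divide_inverse)
  have "u * (q * u) * ((u - inverse u) * (q * u - inverse (q * u))) = (u^2 - 1) * (q^2 * u^2 - 1)"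
    using u assms(1) by (simp add: field_simps power2_eq_square)
  hence "(u - inverse u) * (q * u - inverse (q * u)) = (u^2 - 1) * (q^2 * u^2 - 1) / (q * u^2)"
    using u assms(1) by (simp add: field_simps power2_eq_square)
  hence "step_weight q j = (u^2 - 1) * (q^2 * u^2 - 1) / (q * u^2) / (q - inverse q)^2"
    unfolding step_weight_def qint_def 1 u_def[symmetric] by (simp add: power2_eq_square)
  thus ?thesis
    unfolding step_const_def e using d u assms(1)
    by (simp add: divide_simps mult_ac power2_eq_square)
qed

text \<open>
  The step weights are combinations of \<open>q\<^sup>2\<^sup>j\<close>, \<open>1\<close> and \<open>q\<^sup>-\<^sup>2\<^sup>j\<close>, so they satisfy the recurrence
  whose characteristic roots are \<open>q\<^sup>2\<close>, \<open>1\<close> and \<open>q\<^sup>-\<^sup>2\<close>.  Its coefficients are those of the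
  \<open>q\<close>-Serre relation, which it is responsible for.
\<close>

lemma step_weight_rec:
  fixes q :: "'a::field"
  assumes q: "q \<noteq> 0" "q^2 \<noteq> 1"
  shows "q^2 * (step_weight q (l - 2) - step_weight q (l + 1)) =
    (q^4 + q^2 + 1) * (step_weight q (l - 1) - step_weight q l)"
proof -
  define Q where "Q = q^2"
  define V where "V = qq q l"
  have nz: "Q \<noteq> 0" "V \<noteq> 0" using q by (simp_all add: Q_def V_def qq_nonzero)
  have q4: "q^4 = Q^2" by (simp add: Q_def flip: power_mult)
  have "Q * ((V/Q^2 - 1) * (Q * (V/Q^2) - 1) / (V/Q^2) - (V*Q - 1) * (Q * (V*Q) - 1) / (V*Q)) =
    (Q^2 + Q + 1) * ((V/Q - 1) * (Q * (V/Q) - 1) / (V/Q) - (V - 1) * (Q * V - 1) / V)"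
    using nz by (simp add: field_simps power_numeral_reduce)
  from arg_cong[OF this, of "(*) (step_const q)"] show ?thesis
    unfolding step_weight_eq[OF q] qq_add[OF q(1)] qq_diff[OF q(1)] qq_numeral q4
      Q_def[symmetric] V_def[symmetric]
      right_diff_distrib[of "step_const q", symmetric] mult.left_commute[of _ "step_const q"]
    by (simp only: power_one_right)
qed

lemma q_Serre:
  fixes q :: "'a::field"
  assumes q: "q \<noteq> 0" "q^2 \<noteq> 1"
  shows "q^2 * lower q s t (raise q (raise q (raise q p))) k l =
     q^2 * raise q (raise q (raise q (lower q s t p))) k l
     - (q^4 + q^2 + 1) * raise q (raise q (lower q s t (raise q p))) k l
     + (q^4 + q^2 + 1) * raise q (lower q s t (raise q (raise q p))) k l"
proof -
  define Q where "Q = q^2"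
  define U where "U = qq q k"
  define V where "V = qq q l"
  have nz: "Q \<noteq> 0" "U \<noteq> 0" "V \<noteq> 0" using q by (simp_all add: Q_def U_def V_def qq_nonzero)
  have q4: "q^4 = Q^2" by (simp add: Q_def flip: power_mult)
  \<comment> \<open>Eliminating the largest index turns the claim into a polynomial identity with the remaining
      weights as independent variables.\<close>
  have top: "step_weight q (l + 1) =
      step_weight q (l - 2) - (Q + 1 + 1/Q) * (step_weight q (l - 1) - step_weight q l)" for l
    using step_weight_rec[OF q, of l] nz unfolding q4 Q_def[symmetric]
    by (simp add: field_simps power2_eq_square)
  show ?thesis
    unfolding raise_def lower_def
    using nz
    by (simp add: qq_add[OF q(1)] qq_diff[OF q(1)] qq_minus qq_numeral q4 Q_def[symmetric]
          U_def[symmetric] V_def[symmetric] top[of k] top[of l])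
      (simp add: divide_simps, simp add: algebra_simps power_numeral_reduce)
qed

section \<open>Singular vectors and their raised images\<close>

text \<open>
  On the line \<open>k + l = n\<close> the coordinate function \<open>q\<^sup>2\<^sup>j\<^sup>k\<close>.  The case \<open>j = 0\<close> is the singular
  vector \<open>\<Omega>\<^sub>n\<close>; raising it \<open>m\<close> times gives a combination of the functions with \<open>j \<le> m\<close>, and
  lowering acts diagonally in \<open>j\<close>.
\<close>

definition line_vec :: "'a::field \<Rightarrow> int \<Rightarrow> int \<Rightarrow> 'a vec" where
  "line_vec q n j k l = (if k + l = n then qq q (j * k) else 0)"

lemma lower_line_vec:
  fixes q :: "'a::field"
  assumes q: "q \<noteq> 0"
  shows "lower q s t (line_vec q n j) =
    (\<lambda>k l. (t - s * qq q (j - n - 1)) * line_vec q (n - 1) j k l)"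
proof (intro ext)
  fix k l
  show "lower q s t (line_vec q n j) k l = (t - s * qq q (j - n - 1)) * line_vec q (n - 1) j k l"
    using qq_add[OF q, of "j - n - 1" "j * k"] qq_add[OF q, of "- (k + l + 2)" "j * (k + 1)"]
    by (auto simp: lower_def line_vec_def algebra_simps)
qed

lemma raise_line_vec:
  fixes q :: "'a::field"
  assumes q: "q \<noteq> 0" "q^2 \<noteq> 1"
  shows "raise q (line_vec q n j) k l = step_const q *
   (qq q (n + 2) * (1 - qq q (- j)) * line_vec q (n + 1) (j - 1) k l
   + (1 + q^2) * (qq q (n + 2 - j) - 1) * line_vec q (n + 1) j k l
   + (qq q (- n - 1) - qq q (n + 3 - j)) * line_vec q (n + 1) (j + 1) k l)"
proof (cases "k + l = n + 1")
  case True
  define Q where "Q = q^2"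
  define U where "U = qq q k"
  define W where "W = qq q (j * k)"
  define J where "J = qq q j"
  define E where "E = qq q n"
  have nz: "Q \<noteq> 0" "U \<noteq> 0" "W \<noteq> 0" "E \<noteq> 0" "J \<noteq> 0"
    using q by (simp_all add: Q_def U_def W_def E_def J_def qq_nonzero)
  have ln: "l = n + 1 - k" using True by simp
  have l: "qq q l = Q * E / U"
    unfolding ln qq_diff[OF q(1)] qq_add[OF q(1)] qq_numeral by (simp add: U_def E_def Q_def)
  note R = qq_add[OF q(1)] qq_diff[OF q(1)] qq_minus qq_numeral
    Q_def[symmetric] U_def[symmetric] W_def[symmetric] J_def[symmetric] E_def[symmetric] l
  have m: "line_vec q n j k (l - 1) = W" "line_vec q n j (k - 1) l = W / J"
    "line_vec q (n + 1) (j - 1) k l = W / U" "line_vec q (n + 1) j k l = W"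
    "line_vec q (n + 1) (j + 1) k l = W * U"
    using True by (simp_all add: line_vec_def W_def J_def U_def distrib_left distrib_right
        left_diff_distrib right_diff_distrib qq_add[OF q(1)] qq_diff[OF q(1)])
  show ?thesis
    unfolding raise_def m step_weight_eq[OF q] True R
    using nz by (simp add: divide_simps del: right_minus_eq) algebra
next
  case False
  then show ?thesis by (auto simp: raise_def line_vec_def)
qed

context
  fixes q :: "'a::field" and n :: int and Q E K :: 'a
  assumes q: "q \<noteq> 0" "q^2 \<noteq> 1"
  defines "Q \<equiv> q^2" and "E \<equiv> qq q n" and "K \<equiv> step_const q"
begin

lemma raise_singular:
  "raise q (line_vec q n 0) = (\<lambda>k l. K * (1 + Q) * (Q^2 * E - 1) * line_vec q (n + 1) 0 k l
     + K * ((1 - Q^4 * E^2) / (Q * E)) * line_vec q (n + 1) 1 k l)"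
proof (intro ext)
  fix k l
  have nz: "Q \<noteq> 0" "E \<noteq> 0"
    using q by (simp_all add: Q_def E_def qq_nonzero)
  have c: "qq q (- n - 1) - qq q (n + 3) = (1 - Q^4 * E^2) / (Q * E)"
    unfolding qq_add[OF q(1)] qq_diff[OF q(1)] qq_minus qq_numeral Q_def[symmetric] E_def[symmetric]
    using nz by (simp add: divide_simps del: right_minus_eq) algebra
  have c': "qq q (n + 2) = Q^2 * E"
    unfolding qq_add[OF q(1)] qq_numeral Q_def[symmetric] E_def[symmetric] by simp
  show "raise q (line_vec q n 0) k l = K * (1 + Q) * (Q^2 * E - 1) * line_vec q (n + 1) 0 k l
     + K * ((1 - Q^4 * E^2) / (Q * E)) * line_vec q (n + 1) 1 k l"
    unfolding raise_line_vec[OF q] by (simp add: qq_numeral c c' Q_def K_def algebra_simps)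
qed

lemma raise_raise_singular:
  "raise q (raise q (line_vec q n 0)) = (\<lambda>k l.
     K^2 * ((1 + Q)^2 * (Q^2 * E - 1) * (Q^3 * E - 1) + Q * (Q - 1) * (1 - Q^4 * E^2))
       * line_vec q (n + 2) 0 k l
     + K^2 * ((1 + Q)^2 * (Q^2 * E - 1) * (1 - Q^5 * E^2) / (Q^2 * E))
       * line_vec q (n + 2) 1 k l
     + K^2 * ((1 - Q^4 * E^2) / (Q * E) * ((1 - Q^5 * E^2) / (Q^2 * E)))
       * line_vec q (n + 2) 2 k l)"
proof (intro ext)
  fix k l
  have nz: "Q \<noteq> 0" "E \<noteq> 0"
    using q by (simp_all add: Q_def E_def qq_nonzero)
  note R = qq_add[OF q(1)] qq_diff[OF q(1)] qq_minus qq_numeral Q_def[symmetric] E_def[symmetric]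
  have idx: "n + 1 + 1 = n + 2" "(1::int) + 1 = 2"
    by simp_all
  note R0 = raise_line_vec[OF q, of "n + 1" 0 k l, unfolded idx]
  note R1 = raise_line_vec[OF q, of "n + 1" 1 k l, unfolded idx]
  show "raise q (raise q (line_vec q n 0)) k l =
     K^2 * ((1 + Q)^2 * (Q^2 * E - 1) * (Q^3 * E - 1) + Q * (Q - 1) * (1 - Q^4 * E^2))
       * line_vec q (n + 2) 0 k l
     + K^2 * ((1 + Q)^2 * (Q^2 * E - 1) * (1 - Q^5 * E^2) / (Q^2 * E))
       * line_vec q (n + 2) 1 k l
     + K^2 * ((1 - Q^4 * E^2) / (Q * E) * ((1 - Q^5 * E^2) / (Q^2 * E)))
       * line_vec q (n + 2) 2 k l"
    unfolding raise_singular raise_add raise_scale R0 R1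
    unfolding R K_def[symmetric]
    using nz by (simp add: R divide_simps del: right_minus_eq) algebra
qed

end

text \<open>
  Let \<open>E = q\<^sup>2\<^sup>n\<close>.  Lowering is a component of a tensor operator of spin \<open>1\<close>, so it takes a raised
  image of \<open>\<Omega>\<^sub>n\<close> to a combination of raised images of \<open>\<Omega>\<^sub>n\<^sub>-\<^sub>1\<close>, \<open>\<Omega>\<^sub>n\<close> and \<open>\<Omega>\<^sub>n\<^sub>+\<^sub>1\<close>.  Comparing
  the coefficients of the functions \<open>q\<^sup>2\<^sup>j\<^sup>k\<close>, separately for \<open>s\<close> and for \<open>t\<close>, gives an
  overdetermined linear system for the scalars \<open>a\<close>, \<open>b\<close> and \<open>c\<close> of this combination; the
  following two lemmas say that the stated values solve it.  The argument \<open>E/Q\<close> stands for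
  the line of index \<open>n - 1\<close>.
\<close>

lemma lowering_scalars_1:
  fixes Q E :: "'a::field"
  assumes nz: "Q \<noteq> 0" "E \<noteq> 0" "Q * E \<noteq> 1" "Q * E \<noteq> -1"
  defines "a \<equiv> (Q^2*E - 1) * (Q^2*E + 1) / (Q * (Q*E - 1) * (Q*E + 1))"
    and "b \<equiv> (Q^2 - 1) * (Q^2*E - 1) / (Q * (Q*E + 1))"
  shows "(1 - Q^4*E^2) / (Q*E) = a * ((1 - Q^4*(E/Q)^2) / (Q*(E/Q)))"
    and "(1 + Q) * (Q^2*E - 1) = a * ((1 + Q) * (Q^2*(E/Q) - 1)) + b"
    and "(1 + Q) * (Q^2*E - 1) / (Q^2*E) = a * ((1 + Q) * (Q^2*(E/Q) - 1)) / (Q*E) - b"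
proof -
  have "Q*E + 1 \<noteq> 0"
    using assms by (auto simp: add_eq_0_iff2)
  with nz have nz: "Q \<noteq> 0" "E \<noteq> 0" "Q*E - 1 \<noteq> 0" "Q*E + 1 \<noteq> 0"
    by auto
  show "(1 - Q^4*E^2) / (Q*E) = a * ((1 - Q^4*(E/Q)^2) / (Q*(E/Q)))"
    unfolding a_def using nz by (simp add: divide_simps del: right_minus_eq) algebra
  show "(1 + Q) * (Q^2*E - 1) = a * ((1 + Q) * (Q^2*(E/Q) - 1)) + b"
    unfolding a_def b_def using nz by (simp add: divide_simps del: right_minus_eq) algebra
  show "(1 + Q) * (Q^2*E - 1) / (Q^2*E) = a * ((1 + Q) * (Q^2*(E/Q) - 1)) / (Q*E) - b"
    unfolding a_def b_def using nz by (simp add: divide_simps del: right_minus_eq) algebra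
qed

lemma lowering_scalars_2:
  fixes Q E :: "'a::field"
  assumes nz: "Q \<noteq> 0" "E \<noteq> 0" "Q*E \<noteq> 1" "Q*E \<noteq> -1" "Q^3*E^2 \<noteq> 1" "Q^2*E \<noteq> -1"
  defines "z0 \<equiv> \<lambda>E. (1 + Q)^2 * (Q^2*E - 1) * (Q^3*E - 1) + Q * (Q - 1) * (1 - Q^4*E^2)"
    and "z1 \<equiv> \<lambda>E. (1 + Q)^2 * (Q^2*E - 1) * (1 - Q^5*E^2) / (Q^2*E)"
    and "z2 \<equiv> \<lambda>E. (1 - Q^4*E^2) / (Q*E) * ((1 - Q^5*E^2) / (Q^2*E))"
    and "a \<equiv> (Q^2*E - 1) * (Q^2*E + 1) * (Q^5*E^2 - 1)
        / (Q^2 * (Q*E - 1) * (Q*E + 1) * (Q^3*E^2 - 1))"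
    and "b \<equiv> (Q^2 - 1) * (Q + 1) * (Q^5*E^2 - 1) / (Q^2 * (Q*E + 1) * (Q^2*E + 1))"
    and "c \<equiv> - E * Q * (Q + 1) * (Q - 1)^2 * (Q*E - 1) * (Q^2*E - 1) * (Q^3*E - 1)
        / ((Q^2*E + 1) * (Q^3*E^2 - 1))"
  shows "z2 E = a * z2 (E/Q)"
    and "z1 E = a * z1 (E/Q) + b * ((1 - Q^4*E^2) / (Q*E))"
    and "z0 E = a * z0 (E/Q) + b * ((1 + Q) * (Q^2*E - 1)) - c / (Q^2*E)"
    and "z1 E / (Q^2*E) = a * z1 (E/Q) / (Q*E) - b * ((1 - Q^4*E^2) / (Q*E))"
    and "z0 E / (Q^3*E) = a * z0 (E/Q) / (Q*E) - b * ((1 + Q) * (Q^2*E - 1)) - c"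
proof -
  have "Q*E + 1 \<noteq> 0" "Q^2*E + 1 \<noteq> 0"
    using assms by (auto simp: add_eq_0_iff2)
  with nz have nz: "Q \<noteq> 0" "E \<noteq> 0" "Q*E - 1 \<noteq> 0" "Q*E + 1 \<noteq> 0" "Q^3*E^2 - 1 \<noteq> 0" "Q^2*E + 1 \<noteq> 0"
    by auto
  note D = z0_def z1_def z2_def a_def b_def c_def
  show "z2 E = a * z2 (E/Q)"
    unfolding D using nz by (simp add: divide_simps del: right_minus_eq) algebra
  show "z1 E = a * z1 (E/Q) + b * ((1 - Q^4*E^2) / (Q*E))"
    unfolding D using nz by (simp add: divide_simps del: right_minus_eq) algebra
  show "z0 E = a * z0 (E/Q) + b * ((1 + Q) * (Q^2*E - 1)) - c / (Q^2*E)"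
    unfolding D using nz by (simp add: divide_simps del: right_minus_eq) algebra
  show "z1 E / (Q^2*E) = a * z1 (E/Q) / (Q*E) - b * ((1 - Q^4*E^2) / (Q*E))"
    unfolding D using nz by (simp add: divide_simps del: right_minus_eq) algebra
  show "z0 E / (Q^3*E) = a * z0 (E/Q) / (Q*E) - b * ((1 + Q) * (Q^2*E - 1)) - c"
    unfolding D using nz by (simp add: divide_simps del: right_minus_eq) algebra
qed

context
  fixes q :: "'a::field"
  assumes q0: "q \<noteq> 0" and not_root: "\<And>n::nat. n \<ge> 1 \<Longrightarrow> q ^ n \<noteq> 1"
begin

lemma q2_neq_1: "q^2 \<noteq> 1"
  using not_root[of 2] by simp

lemma denominators_nonzero:
  fixes n :: nat
  defines "Q \<equiv> q^2" and "E \<equiv> qq q (int n)"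
  shows "E \<noteq> 0" "Q*E \<noteq> 1" "Q*E \<noteq> -1" "Q^3*E^2 \<noteq> 1" "Q^2*E \<noteq> -1"
proof -
  have E: "E = q ^ (2 * n)"
    by (simp add: E_def qq_of_nat power_mult)
  have eq: "Q*E = q ^ (2 + 2 * n)" "Q^3*E^2 = q ^ (2 * 3 + 2 * n * 2)"
    and sq: "(Q*E)^2 = q ^ ((2 + 2 * n) * 2)" "(Q^2*E)^2 = q ^ ((2 * 2 + 2 * n) * 2)"
    unfolding E Q_def by (simp_all only: power_add power_mult)
  show "Q*E \<noteq> 1" "Q^3*E^2 \<noteq> 1"
    unfolding eq by (rule not_root, simp)+
  have "(Q*E)^2 \<noteq> 1" "(Q^2*E)^2 \<noteq> 1"
    unfolding sq by (rule not_root, simp)+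
  then show "Q*E \<noteq> -1" "Q^2*E \<noteq> -1"
    by auto
  show "E \<noteq> 0"
    using q0 by (simp add: E_def qq_nonzero)
qed

text \<open>
  What matters in the next two lemmas is how the scalars depend on \<open>s\<close> and \<open>t\<close>: the coefficient of
  \<open>\<Omega>\<^sub>n\<close> is symmetric, the factor at \<open>\<Omega>\<^sub>n\<^sub>+\<^sub>1\<close> turns \<open>D\<^sub>n\<close> into \<open>D\<^sub>n\<^sub>+\<^sub>1\<close>, and the factor at
  \<open>\<Omega>\<^sub>n\<^sub>-\<^sub>1\<close> is the mirror image of the last factor of \<open>D\<^sub>n\<close>.
\<close>

lemma lower_raise_singular:
  fixes n :: nat
  obtains a b where "\<And>s t k l. lower q s t (raise q (line_vec q (int n) 0)) k l =
     a * (t - s * qq q (- int n - 1)) * raise q (line_vec q (int n - 1) 0) k l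
     + b * (s + t) * line_vec q (int n) 0 k l"
proof -
  define Q where "Q = q^2"
  define E where "E = qq q (int n)"
  define K where "K = step_const q"
  have "Q \<noteq> 0"
    using q0 by (simp add: Q_def)
  note nz = this denominators_nonzero[of n, folded Q_def E_def]
  define a where "a = (Q^2*E - 1) * (Q^2*E + 1) / (Q * (Q*E - 1) * (Q*E + 1))"
  define b where "b = (Q^2 - 1) * (Q^2*E - 1) / (Q * (Q*E + 1))"
  note S = lowering_scalars_1[OF nz(1-4), folded a_def b_def]
  have F: "qq q (int n - 1) = E / Q"
    by (simp add: qq_diff[OF q0] qq_numeral E_def Q_def)
  have e: "qq q (- int n - 1) = 1 / (Q*E)" "qq q (0 - (int n + 1) - 1) = 1 / (Q^2*E)"
    "qq q (1 - (int n + 1) - 1) = 1 / (Q*E)"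
    unfolding qq_diff[OF q0] qq_minus qq_add[OF q0] qq_numeral E_def Q_def
    by (simp_all add: field_simps power2_eq_square)
  have "lower q s t (raise q (line_vec q (int n) 0)) k l =
     a * (t - s * qq q (- int n - 1)) * raise q (line_vec q (int n - 1) 0) k l
     + (K * b) * (s + t) * line_vec q (int n) 0 k l" for s t k l
  proof -
    define A0 where "A0 = (1 + Q) * (Q^2*E - 1)"
    define A1 where "A1 = (1 - Q^4*E^2) / (Q*E)"
    define B0 where "B0 = (1 + Q) * (Q^2*(E/Q) - 1)"
    define B1 where "B1 = (1 - Q^4*(E/Q)^2) / (Q*(E/Q))"
    define d where "d = 1 / (Q*E)"
    define d2 where "d2 = 1 / (Q^2*E)"
    define x where "x = line_vec q (int n) 0 k l"
    define y where "y = line_vec q (int n) 1 k l"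
    have L: "lower q s t (raise q (line_vec q (int n) 0)) k l =
        K * A0 * ((t - s * d2) * x) + K * A1 * ((t - s * d) * y)"
      unfolding raise_singular[OF q0 q2_neq_1] lower_add lower_scale lower_line_vec[OF q0] e
      by (simp add: A0_def A1_def K_def Q_def E_def x_def y_def d_def d2_def mult.assoc)
    have R: "raise q (line_vec q (int n - 1) 0) k l = K * B0 * x + K * B1 * y"
      unfolding raise_singular[OF q0 q2_neq_1] F
      by (simp add: B0_def B1_def K_def Q_def x_def y_def mult.assoc)
    have S': "A1 = a * B1" "A0 = a * B0 + b" "A0 * d2 = a * B0 * d - b"
      using S by (simp_all add: A0_def A1_def B0_def B1_def d_def d2_def)
    show ?thesis
      unfolding L R e x_def[symmetric] d_def[symmetric] using S' by algebra
  qed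
  then show ?thesis by (rule that)
qed

lemma lower_raise_raise_singular:
  fixes n :: nat
  obtains a b c where "\<And>s t k l. lower q s t (raise q (raise q (line_vec q (int n) 0))) k l =
     a * (t - s * qq q (- int n - 1)) * raise q (raise q (line_vec q (int n - 1) 0)) k l
     + b * (s + t) * raise q (line_vec q (int n) 0) k l
     + c * (s - t * qq q (- int n - 2)) * line_vec q (int n + 1) 0 k l"
proof -
  define Q where "Q = q^2"
  define E where "E = qq q (int n)"
  define K where "K = step_const q"
  have "Q \<noteq> 0"
    using q0 by (simp add: Q_def)
  note nz = this denominators_nonzero[of n, folded Q_def E_def]
  define a where "a = (Q^2*E - 1) * (Q^2*E + 1) * (Q^5*E^2 - 1)
    / (Q^2 * (Q*E - 1) * (Q*E + 1) * (Q^3*E^2 - 1))"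
  define b where "b = (Q^2 - 1) * (Q + 1) * (Q^5*E^2 - 1) / (Q^2 * (Q*E + 1) * (Q^2*E + 1))"
  define c where "c = - E * Q * (Q + 1) * (Q - 1)^2 * (Q*E - 1) * (Q^2*E - 1) * (Q^3*E - 1)
    / ((Q^2*E + 1) * (Q^3*E^2 - 1))"
  define z0 where "z0 = (\<lambda>E. (1 + Q)^2 * (Q^2*E - 1) * (Q^3*E - 1) + Q * (Q - 1) * (1 - Q^4*E^2))"
  define z1 where "z1 = (\<lambda>E. (1 + Q)^2 * (Q^2*E - 1) * (1 - Q^5*E^2) / (Q^2*E))"
  define z2 where "z2 = (\<lambda>E. (1 - Q^4*E^2) / (Q*E) * ((1 - Q^5*E^2) / (Q^2*E)))"
  have S: "z2 E = a * z2 (E/Q)"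
    "z1 E = a * z1 (E/Q) + b * ((1 - Q^4*E^2) / (Q*E))"
    "z0 E = a * z0 (E/Q) + b * ((1 + Q) * (Q^2*E - 1)) - c / (Q^2*E)"
    "z1 E / (Q^2*E) = a * z1 (E/Q) / (Q*E) - b * ((1 - Q^4*E^2) / (Q*E))"
    "z0 E / (Q^3*E) = a * z0 (E/Q) / (Q*E) - b * ((1 + Q) * (Q^2*E - 1)) - c"
    unfolding z0_def z1_def z2_def a_def b_def c_def by (rule lowering_scalars_2[OF nz])+
  have F: "qq q (int n - 1) = E / Q"
    by (simp add: qq_diff[OF q0] qq_numeral E_def Q_def)
  have e: "qq q (- int n - 1) = 1 / (Q*E)" "qq q (- int n - 2) = 1 / (Q^2*E)"
    "qq q (0 - (int n + 2) - 1) = 1 / (Q^3*E)"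
    "qq q (1 - (int n + 2) - 1) = 1 / (Q^2*E)"
    "qq q (2 - (int n + 2) - 1) = 1 / (Q*E)"
    unfolding qq_diff[OF q0] qq_minus qq_add[OF q0] qq_numeral E_def Q_def
    using q0 by (simp_all add: field_simps power_numeral_reduce)
  have idx: "int n + 2 - 1 = int n + 1" "int n - 1 + 2 = int n + 1"
    by simp_all
  have "lower q s t (raise q (raise q (line_vec q (int n) 0))) k l =
     a * (t - s * qq q (- int n - 1)) * raise q (raise q (line_vec q (int n - 1) 0)) k l
     + (K * b) * (s + t) * raise q (line_vec q (int n) 0) k l
     + (K^2 * c) * (s - t * qq q (- int n - 2)) * line_vec q (int n + 1) 0 k l" for s t k l
  proof -
    define A0 where "A0 = (1 + Q) * (Q^2*E - 1)"
    define A1 where "A1 = (1 - Q^4*E^2) / (Q*E)"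
    define d where "d = 1 / (Q*E)"
    define d2 where "d2 = 1 / (Q^2*E)"
    define d3 where "d3 = 1 / (Q^3*E)"
    define Z0 where "Z0 = z0 E"
    define Z1 where "Z1 = z1 E"
    define Z2 where "Z2 = z2 E"
    define Y0 where "Y0 = z0 (E/Q)"
    define Y1 where "Y1 = z1 (E/Q)"
    define Y2 where "Y2 = z2 (E/Q)"
    define x where "x = line_vec q (int n + 1) 0 k l"
    define y where "y = line_vec q (int n + 1) 1 k l"
    define z where "z = line_vec q (int n + 1) 2 k l"
    have L: "lower q s t (raise q (raise q (line_vec q (int n) 0))) k l =
        K^2 * Z0 * ((t - s * d3) * x) + K^2 * Z1 * ((t - s * d2) * y) + K^2 * Z2 * ((t - s * d) * z)"
      unfolding raise_raise_singular[OF q0 q2_neq_1] lower_add lower_scale lower_line_vec[OF q0] e idx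
      by (simp add: Z0_def Z1_def Z2_def z0_def z1_def z2_def K_def Q_def E_def x_def y_def z_def
          d_def d2_def d3_def)
    have R: "raise q (line_vec q (int n) 0) k l = K * A0 * x + K * A1 * y"
      unfolding raise_singular[OF q0 q2_neq_1]
      by (simp add: A0_def A1_def K_def Q_def E_def x_def y_def mult.assoc)
    have R2: "raise q (raise q (line_vec q (int n - 1) 0)) k l =
        K^2 * Y0 * x + K^2 * Y1 * y + K^2 * Y2 * z"
      unfolding raise_raise_singular[OF q0 q2_neq_1] F idx
      by (simp add: Y0_def Y1_def Y2_def z0_def z1_def z2_def K_def Q_def x_def y_def z_def)
    have S': "Z2 = a * Y2" "Z1 = a * Y1 + b * A1" "Z0 = a * Y0 + b * A0 - c * d2"
      "Z1 * d2 = a * Y1 * d - b * A1" "Z0 * d3 = a * Y0 * d - b * A0 - c"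
      using S by (simp_all add: A0_def A1_def Z0_def Z1_def Z2_def Y0_def Y1_def Y2_def
          d_def d2_def d3_def)
    show ?thesis
      unfolding L R R2 e x_def[symmetric] d_def[symmetric] d2_def[symmetric]
      using S' by algebra
  qed
  then show ?thesis by (rule that)
qed

section \<open>Symmetric families\<close>

definition singular_factor :: "nat \<Rightarrow> 'a \<Rightarrow> 'a \<Rightarrow> 'a" where
  "singular_factor n s t = (\<Prod>j=1..n. s - t * qq q (- int j - 1))"

text \<open>
  Families \<open>\<alpha>(s, t)\<close> of vectors of \<open>V(s) \<otimes> V(t)\<close> which the \<open>R\<close>-matrix takes to
  \<open>\<alpha>(t, s)\<close>.  Families that vanish on the quadrant represent the zero vector.
\<close>

inductive symmetric_family :: "('a \<Rightarrow> 'a \<Rightarrow> 'a vec) \<Rightarrow> bool" where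
  singular: "symmetric_family (\<lambda>s t k l. singular_factor n s t * line_vec q (int n) 0 k l)"
| negligible: "(\<And>s t k l. 0 \<le> k \<Longrightarrow> 0 \<le> l \<Longrightarrow> \<alpha> s t k l = 0) \<Longrightarrow> symmetric_family \<alpha>"
| add: "symmetric_family \<alpha> \<Longrightarrow> symmetric_family \<beta> \<Longrightarrow>
    symmetric_family (\<lambda>s t k l. \<alpha> s t k l + \<beta> s t k l)"
| scale: "symmetric_family \<alpha> \<Longrightarrow> (\<And>s t. c s t = c t s) \<Longrightarrow>
    symmetric_family (\<lambda>s t k l. c s t * \<alpha> s t k l)"
| raise: "symmetric_family \<alpha> \<Longrightarrow> symmetric_family (\<lambda>s t. raise q (\<alpha> s t))"

text \<open>
  Lowering \<open>D\<^sub>n \<Omega>\<^sub>n\<close> produces the factor \<open>t - q\<^sup>-\<^sup>2\<^sup>n\<^sup>-\<^sup>2 s\<close>, which completes the last factor of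
  \<open>D\<^sub>n\<close> to a symmetric polynomial.
\<close>

lemma symmetric_family_lowered_singular:
  "symmetric_family (\<lambda>s t k l. singular_factor n s t * (t - s * qq q (- int n - 1))
     * line_vec q (int n - 1) 0 k l)"
proof (cases n)
  case 0
  then show ?thesis
    by (intro negligible) (auto simp: line_vec_def)
next
  case (Suc m)
  let ?c = "\<lambda>s t. (s - t * qq q (- int n - 1)) * (t - s * qq q (- int n - 1))"
  have "symmetric_family (\<lambda>s t k l. ?c s t * (singular_factor m s t * line_vec q (int m) 0 k l))"
    by (intro scale singular) (simp add: mult.commute)
  moreover have "(\<lambda>s t k l. ?c s t * (singular_factor m s t * line_vec q (int m) 0 k l)) =
      (\<lambda>s t k l. singular_factor n s t * (t - s * qq q (- int n - 1))
         * line_vec q (int n - 1) 0 k l)"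
    by (intro ext) (simp add: Suc singular_factor_def mult_ac)
  ultimately show ?thesis by simp
qed

definition lowers_thrice :: "('a \<Rightarrow> 'a \<Rightarrow> 'a vec) \<Rightarrow> bool" where
  "lowers_thrice \<alpha> \<longleftrightarrow> symmetric_family (\<lambda>s t. lower q s t (\<alpha> s t))
     \<and> symmetric_family (\<lambda>s t. lower q s t (raise q (\<alpha> s t)))
     \<and> symmetric_family (\<lambda>s t. lower q s t (raise q (raise q (\<alpha> s t))))"

lemma lowers_thrice_singular:
  "lowers_thrice (\<lambda>s t k l. singular_factor n s t * line_vec q (int n) 0 k l)"
proof -
  let ?D = "singular_factor n"
  let ?M = "line_vec q (int n) 0"
  let ?lam = "\<lambda>s t. t - s * qq q (- int n - 1)"
  let ?low = "\<lambda>s t k l. ?D s t * ?lam s t * line_vec q (int n - 1) 0 k l"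
  have low: "symmetric_family ?low"
    by (rule symmetric_family_lowered_singular)
  have up: "symmetric_family
      (\<lambda>s t k l. singular_factor (Suc n) s t * line_vec q (int (Suc n)) 0 k l)"
    by (rule singular)
  have "(\<lambda>s t. lower q s t (\<lambda>k l. ?D s t * ?M k l)) = ?low"
    by (intro ext) (simp add: lower_scale lower_line_vec[OF q0] mult.assoc)
  with low have 0: "symmetric_family (\<lambda>s t. lower q s t (\<lambda>k l. ?D s t * ?M k l))"
    by simp
  obtain a b where ab: "\<And>s t k l. lower q s t (raise q ?M) k l =
     a * ?lam s t * raise q (line_vec q (int n - 1) 0) k l + b * (s + t) * ?M k l"
    using lower_raise_singular[of n] by metis
  have "symmetric_family (\<lambda>s t k l. a * raise q (?low s t) k l
      + (b * (s + t)) * (?D s t * ?M k l))"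
    by (intro add scale raise low singular) (simp_all add: add.commute)
  moreover have "(\<lambda>s t k l. a * raise q (?low s t) k l + (b * (s + t)) * (?D s t * ?M k l)) =
      (\<lambda>s t. lower q s t (raise q (\<lambda>k l. ?D s t * ?M k l)))"
    unfolding raise_scale lower_scale ab by (intro ext) algebra
  ultimately have 1: "symmetric_family (\<lambda>s t. lower q s t (raise q (\<lambda>k l. ?D s t * ?M k l)))"
    by simp
  obtain a b c where abc: "\<And>s t k l. lower q s t (raise q (raise q ?M)) k l =
     a * ?lam s t * raise q (raise q (line_vec q (int n - 1) 0)) k l
     + b * (s + t) * raise q ?M k l
     + c * (s - t * qq q (- int n - 2)) * line_vec q (int n + 1) 0 k l"
    using lower_raise_raise_singular[of n] by metis
  have "symmetric_family (\<lambda>s t k l. (a * raise q (raise q (?low s t)) k l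
      + (b * (s + t)) * raise q (\<lambda>k l. ?D s t * ?M k l) k l)
      + c * (singular_factor (Suc n) s t * line_vec q (int (Suc n)) 0 k l))"
    by (intro add scale raise low singular up)
      (simp_all add: add.commute)
  moreover have "(\<lambda>s t k l. (a * raise q (raise q (?low s t)) k l
      + (b * (s + t)) * raise q (\<lambda>k l. ?D s t * ?M k l) k l)
      + c * (singular_factor (Suc n) s t * line_vec q (int (Suc n)) 0 k l)) =
      (\<lambda>s t. lower q s t (raise q (raise q (\<lambda>k l. ?D s t * ?M k l))))"
  proof (intro ext)
    fix s t k l
    have "- int (Suc n) - 1 = - int n - 2"
      by simp
    moreover have "singular_factor (Suc n) s t = ?D s t * (s - t * qq q (- int (Suc n) - 1))"
      unfolding singular_factor_def by (simp add: mult.commute)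
    ultimately have D: "singular_factor (Suc n) s t = ?D s t * (s - t * qq q (- int n - 2))"
      by (simp only:)
    have i: "int (Suc n) = int n + 1"
      by simp
    show "(a * raise q (raise q (?low s t)) k l
      + (b * (s + t)) * raise q (\<lambda>k l. ?D s t * ?M k l) k l)
      + c * (singular_factor (Suc n) s t * line_vec q (int (Suc n)) 0 k l) =
      lower q s t (raise q (raise q (\<lambda>k l. ?D s t * ?M k l))) k l"
      unfolding D i raise_scale lower_scale abc by algebra
  qed
  ultimately have 2: "symmetric_family
      (\<lambda>s t. lower q s t (raise q (raise q (\<lambda>k l. ?D s t * ?M k l))))"
    by simp
  from 0 1 2 show ?thesis
    unfolding lowers_thrice_def by simp
qed

text \<open>
  The \<open>q\<close>-Serre relation expresses the third raised image, lowered, through the previous ones, so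
  the three conditions together are inherited by the raised family.
\<close>

lemma lowers_thrice_raise:
  assumes "lowers_thrice \<alpha>"
  shows "lowers_thrice (\<lambda>s t. raise q (\<alpha> s t))"
proof -
  define c where "c = (q^4 + q^2 + 1) / q^2"
  from assms have h: "symmetric_family (\<lambda>s t. lower q s t (\<alpha> s t))"
    "symmetric_family (\<lambda>s t. lower q s t (raise q (\<alpha> s t)))"
    "symmetric_family (\<lambda>s t. lower q s t (raise q (raise q (\<alpha> s t))))"
    by (simp_all add: lowers_thrice_def)
  let ?R3 = "\<lambda>s t. raise q (raise q (raise q (lower q s t (\<alpha> s t))))"
  let ?R2 = "\<lambda>s t. raise q (raise q (lower q s t (raise q (\<alpha> s t))))"
  let ?R1 = "\<lambda>s t. raise q (lower q s t (raise q (raise q (\<alpha> s t))))"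
  have r3: "symmetric_family ?R3"
    by (intro raise h)
  have r2: "symmetric_family (\<lambda>s t k l. - c * ?R2 s t k l)"
    by (intro scale raise h refl)
  have r1: "symmetric_family (\<lambda>s t k l. c * ?R1 s t k l)"
    by (intro scale raise h refl)
  have "symmetric_family (\<lambda>s t k l. (?R3 s t k l + - c * ?R2 s t k l) + c * ?R1 s t k l)"
    by (rule add[OF add[OF r3 r2] r1])
  moreover have "(\<lambda>s t k l. (?R3 s t k l + - c * ?R2 s t k l) + c * ?R1 s t k l) =
      (\<lambda>s t. lower q s t (raise q (raise q (raise q (\<alpha> s t)))))"
  proof (intro ext)
    fix s t k l
    have solve: "(r3 + - (u / z) * r2) + u / z * r1 = r0"
      if "z * r0 = z * r3 - u * r2 + u * r1" "z \<noteq> 0" for z u r0 r1 r2 r3 :: 'a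
      using that by (simp add: field_simps)
    show "(?R3 s t k l + - c * ?R2 s t k l) + c * ?R1 s t k l =
      lower q s t (raise q (raise q (raise q (\<alpha> s t)))) k l"
      unfolding c_def by (rule solve[OF q_Serre[OF q0 q2_neq_1]]) (simp add: q0)
  qed
  ultimately show ?thesis
    using h by (simp add: lowers_thrice_def)
qed

lemma negligible_raise:
  assumes "\<And>k l. 0 \<le> k \<Longrightarrow> 0 \<le> l \<Longrightarrow> p k l = 0" "0 \<le> k" "0 \<le> l"
  shows "raise q p k l = 0"
  using assms by (cases "k = 0"; cases "l = 0") (auto simp: raise_def step_weight_def)

lemma negligible_lower:
  assumes "\<And>k l. 0 \<le> k \<Longrightarrow> 0 \<le> l \<Longrightarrow> p k l = 0" "0 \<le> k" "0 \<le> l"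
  shows "lower q s t p k l = 0"
  using assms by (simp add: lower_def)

lemma symmetric_family_lowers_thrice: "symmetric_family \<alpha> \<Longrightarrow> lowers_thrice \<alpha>"
proof (induction rule: symmetric_family.induct)
  case (singular n)
  then show ?case by (rule lowers_thrice_singular)
next
  case (negligible \<alpha>)
  then show ?case
    unfolding lowers_thrice_def
    by (intro conjI symmetric_family.negligible negligible_lower negligible_raise) auto
next
  case (add \<alpha> \<beta>)
  then show ?case
    by (simp add: lowers_thrice_def lower_add raise_add symmetric_family.add)
next
  case (scale \<alpha> c)
  then show ?case
    by (simp add: lowers_thrice_def lower_scale raise_scale symmetric_family.scale)
next
  case (raise \<alpha>)
  then show ?case by (intro lowers_thrice_raise)
qed

lemma symmetric_family_lower:
  "symmetric_family \<alpha> \<Longrightarrow> symmetric_family (\<lambda>s t. lower q s t (\<alpha> s t))"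
  using symmetric_family_lowers_thrice by (auto simp: lowers_thrice_def)

lemma symmetric_family_origin: "symmetric_family \<alpha> \<Longrightarrow> \<alpha> s t 0 0 = \<alpha> t s 0 0"
proof (induction rule: symmetric_family.induct)
  case (singular n)
  then show ?case
    by (cases n) (simp_all add: line_vec_def singular_factor_def)
next
  case (scale \<alpha> c)
  show ?case
    unfolding scale.IH using scale.hyps(2)[of s t] by simp
qed (simp_all add: raise_def step_weight_def)

lemma symmetric_family_coef:
  "symmetric_family \<alpha> \<Longrightarrow> coef q s t w (\<alpha> s t) = coef q t s w (\<alpha> t s)"
proof (induction w arbitrary: \<alpha>)
  case Nil
  then show ?case by (simp add: symmetric_family_origin)
next
  case (Cons a w)
  show ?case
    using Cons.IH[OF raise[OF Cons.prems]] Cons.IH[OF symmetric_family_lower[OF Cons.prems]]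
    by (cases a) simp_all
qed

text \<open>On the quadrant the line \<open>k + l = 0\<close> is just the origin.\<close>

lemma symmetric_family_unit_vec: "symmetric_family (\<lambda>s t. unit_vec 0 0)"
proof -
  let ?rest = "\<lambda>(s::'a) (t::'a) k l. unit_vec 0 0 k l - singular_factor 0 s t * line_vec q (int 0) 0 k l"
  have "symmetric_family ?rest"
    by (intro negligible) (auto simp: unit_vec_def line_vec_def singular_factor_def qq_numeral)
  from add[OF singular[of 0] this] show ?thesis by simp
qed

lemma path_shuffle_symmetric:
  "shuf q w (path_series q s 0) (path_series q t 0) =
   shuf q w (path_series q t 0) (path_series q s 0)"
  using symmetric_family_coef[OF symmetric_family_unit_vec, of s t w]
    path_shuffle_coef[OF q0, of 0 0 w s t] path_shuffle_coef[OF q0, of 0 0 w t s]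
  by (simp add: gauge_def)

section \<open>Separating the degrees\<close>

lemma infinite_field: "infinite (UNIV :: 'a set)"
proof
  assume "finite (UNIV :: 'a set)"
  then have "finite (range (\<lambda>n::nat. q ^ n))"
    by (rule finite_subset[OF subset_UNIV])
  then have "\<not> inj (\<lambda>n::nat. q ^ n)"
    using finite_imageD infinite_UNIV_nat by blast
  then obtain m n :: nat where "q ^ m = q ^ n" "m \<noteq> n"
    unfolding inj_on_def by blast
  then obtain m n :: nat where mn: "m < n" "q ^ m = q ^ n"
    by (cases "m < n") (auto simp: not_less le_less)
  have "q ^ m * q ^ (n - m) = q ^ n"
    using mn(1) by (simp only: power_add[symmetric] le_add_diff_inverse less_imp_le_nat)
  with mn have "q ^ m * q ^ (n - m) = q ^ m * 1"
    by simp
  with q0 mn not_root[of "n - m"] show False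
    by simp
qed

lemma shuf_graded_path_commute:
  "shuf q w (graded_part i (path_weight q 0)) (graded_part j (path_weight q 0)) =
   shuf q w (graded_part j (path_weight q 0)) (graded_part i (path_weight q 0))"
proof (cases "i + j = downs w")
  case False
  then show ?thesis
    by (simp add: shuf_graded_part_eq_0 add.commute)
next
  case True
  let ?S = "\<lambda>i j. shuf q w (graded_part i (path_weight q 0)) (graded_part j (path_weight q 0))"
  let ?M = "downs w"
  define P where "P = (\<Sum>i\<le>?M. monom (?S i (?M - i) - ?S (?M - i) i) i)"
  have "poly P s = 0" for s
  proof -
    have "(\<Sum>i\<le>?M. s ^ i * ?S i (?M - i)) = (\<Sum>i\<le>?M. s ^ (?M - i) * ?S i (?M - i))"
      using path_shuffle_symmetric[of w s 1] shuf_weighted[of q w s "path_weight q 0" 1 "path_weight q 0"]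
        shuf_weighted[of q w 1 "path_weight q 0" s "path_weight q 0"]
      by (simp add: path_series_def[abs_def])
    also have "\<dots> = (\<Sum>i\<le>?M. s ^ i * ?S (?M - i) i)"
      by (rule sum.reindex_bij_witness[of _ "\<lambda>i. ?M - i" "\<lambda>i. ?M - i"]) auto
    finally show ?thesis
      by (simp add: P_def poly_sum poly_monom algebra_simps sum_subtractf)
  qed
  then have "P = 0"
    using poly_roots_finite[of P] infinite_field by auto
  then have "coeff P i = 0"
    by simp
  moreover have "coeff P i = ?S i (?M - i) - ?S (?M - i) i"
    using True by (simp add: P_def coeff_sum)
  ultimately show ?thesis
    using True by (metis add_diff_cancel_left' right_minus_eq)
qed

end

theorem corollary1p8:
  fixes q :: "'a::field" and i j :: nat
  assumes "q \<noteq> 0"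
    and "\<And>n::nat. n \<ge> 1 \<Longrightarrow> q ^ n \<noteq> 1"
  shows "qshuffle q (Catalan_elt q i) (Catalan_elt q j) =
         qshuffle q (Catalan_elt q j) (Catalan_elt q i)"
proof (rule poly_mapping_eqI)
  fix w
  have "q - inverse q \<noteq> 0"
    using assms(1) assms(2)[of 2] by (simp add: field_simps power2_eq_square)
  then have "qint q 1 = 1"
    by (simp add: qint_def power_int_minus)
  then show "Poly_Mapping.lookup (qshuffle q (Catalan_elt q i) (Catalan_elt q j)) w =
      Poly_Mapping.lookup (qshuffle q (Catalan_elt q j) (Catalan_elt q i)) w"
    by (simp add: lookup_qshuffle lookup_Catalan_elt shuf_graded_path_commute[OF assms])
qed

end
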